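(* Let $G$ be a connected graph with at least two vertices such that $\gamma_t(G)\leq a(G)+1$, and let $\mu(G)$ be the Mycielski graph of $G$. Then $\gamma_t(\mu(G))\leq a(\mu(G))+1$.
   Context: All graphs are finite and simple. $m(G)$ denotes the number of edges of $G$. A total dominating set of $G$ is a set $D\subseteq V(G)$ such that every vertex of $V(G)$ has a neighbor in $D$; the total domination number $\gamma_t(G)$ is the minimum cardinality of a total dominating set of $G$. If $d_1\leq d_2\leq\cdots\leq d_n$ is the ordered degree sequence of $G$, the annihilation number $a(G)$ is the largest integer $k$ with $k\le n$ such that $\sum_{i=1}^{k} d_i\leq m(G)$. The Mycielski graph $\mu(G)$ of a graph $G$ with vertices $v_1,\ldots,v_n$ contains $G$ itself together with $n+1$ additional vertices: a vertex $u_i$ for each vertex $v_i$ of $G$, and another vertex $w$. Besides the edges of $G$, the edges of $\mu(G)$ are $wu_i$ for all $i$, and, for each edge $v_iv_j$ of $G$, the edges $u_iv_j$ and $v_iu_j$. *)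

theory Defs
  imports "HOL-Library.Multiset" "Graph_Theory.Graph_Theory"
begin

text \<open>
  Finite simple graphs are the \<open>pair_graph\<close>s of Graph_Theory: finite, loop-free
  digraphs with a symmetric arc relation. An undirected edge \<open>uv\<close> is thus the pair of arcs
  \<open>(u,v)\<close> and \<open>(v,u)\<close>, and the degree of \<open>v\<close> is \<open>out_degree G v\<close> (which equals its in-degree).
\<close>

definition edges :: "'a pair_pre_digraph \<Rightarrow> 'a set set" where
  "edges G = {{u, v} | u v. (u, v) \<in> parcs G}"

definition num_edges :: "'a pair_pre_digraph \<Rightarrow> nat" where
  "num_edges G = card (edges G)"

definition total_dominating_set :: "'a pair_pre_digraph \<Rightarrow> 'a set \<Rightarrow> bool" where
  "total_dominating_set G D \<longleftrightarrow>
     D \<subseteq> pverts G \<and> (\<forall>v\<in>pverts G. \<exists>u\<in>D. (v, u) \<in> parcs G)"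

text \<open>Meaningful only for finite graphs without isolated vertices; see
  \<open>ex_total_dominating_set\<close> and \<open>ex_total_dominating_set_mycielski\<close> below.\<close>

definition total_domination_number :: "'a pair_pre_digraph \<Rightarrow> nat" where
  "total_domination_number G = Min {card D | D. total_dominating_set G D}"

text \<open>The degrees with multiplicity, in nondecreasing order: \<open>degree_sequence G ! i\<close>
  is \<open>d\<close> with index \<open>i + 1\<close>.\<close>

definition degree_sequence :: "'a pair_pre_digraph \<Rightarrow> nat list" where
  "degree_sequence G =
     sorted_list_of_multiset (image_mset (out_degree (with_proj G)) (mset_set (pverts G)))"

definition annihilation_number :: "'a pair_pre_digraph \<Rightarrow> nat" where
  "annihilation_number G =
     Max {k. k \<le> card (pverts G) \<and> (\<Sum>i<k. degree_sequence G ! i) \<le> num_edges G}"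

datatype 'a mycielski_vertex = Orig 'a | Copy 'a | Apex

definition mycielski :: "'a pair_pre_digraph \<Rightarrow> 'a mycielski_vertex pair_pre_digraph" where
  "mycielski G = \<lparr>
     pverts = Orig ` pverts G \<union> Copy ` pverts G \<union> {Apex},
     parcs = {(Orig u, Orig v) | u v. (u, v) \<in> parcs G}
           \<union> {(Copy u, Orig v) | u v. (u, v) \<in> parcs G}
           \<union> {(Orig u, Copy v) | u v. (u, v) \<in> parcs G}
           \<union> {(Apex, Copy v) | v. v \<in> pverts G}
           \<union> {(Copy v, Apex) | v. v \<in> pverts G} \<rparr>"

lemma pair_graph_mycielski:
  assumes "pair_graph G"
  shows "pair_graph (mycielski G)"
proof -
  interpret pair_graph G by fact
  have sub: "parcs (mycielski G) \<subseteq> pverts (mycielski G) \<times> pverts (mycielski G)"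
    by (auto simp: mycielski_def dest: in_arcsD1 in_arcsD2)
  have fin: "finite (pverts (mycielski G))"
    using pair_finite_verts by (simp add: mycielski_def)
  have "sym (parcs (mycielski G))"
    by (rule symI) (auto simp: mycielski_def intro: arcs_symmetric)
  moreover have "fst e \<noteq> snd e" if "e \<in> parcs (mycielski G)" for e
    using that by (auto simp: mycielski_def dest: no_loops')
  moreover have "finite (parcs (mycielski G))"
    using sub fin by (meson finite_SigmaI finite_subset)
  ultimately show ?thesis
    using sub fin by unfold_locales (auto simp: symmetric_def)
qed

lemma length_degree_sequence: "length (degree_sequence G) = card (pverts G)"
proof -
  have "length (degree_sequence G) = size (mset (degree_sequence G))"
    by (simp only: size_mset)
  also have "\<dots> = card (pverts G)"
    by (simp add: degree_sequence_def)
  finally show ?thesis .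
qed

lemma ex_total_dominating_set:
  assumes "pair_graph G" "connected (with_proj G)" "card (pverts G) \<ge> 2"
  shows "total_dominating_set G (pverts G)"
  unfolding total_dominating_set_def
proof (intro conjI ballI subset_refl)
  interpret pair_graph G by fact
  fix v assume v: "v \<in> pverts G"
  have "pverts G \<noteq> {v}" using assms(3) by auto
  then obtain u where u: "u \<in> pverts G" "u \<noteq> v" using v by blast
  have "strongly_connected (with_proj G)"
    using symmetric_connected_imp_strongly_connected assms(2) sym_arcs by blast
  then have "v \<rightarrow>\<^sup>*\<^bsub>with_proj G\<^esub> u"
    using u v by (auto simp: strongly_connected_def)
  then show "\<exists>u\<in>pverts G. (v, u) \<in> parcs G"
    using u by (cases rule: converse_reachable_cases) (auto dest: in_arcsD2)
qed

lemma ex_total_dominating_set_mycielski: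
  assumes "pair_graph G" "connected (with_proj G)" "card (pverts G) \<ge> 2"
  shows "total_dominating_set (mycielski G) (pverts (mycielski G))"
proof -
  have nbr: "\<forall>v\<in>pverts G. \<exists>u\<in>pverts G. (v, u) \<in> parcs G" and ne: "pverts G \<noteq> {}"
    using ex_total_dominating_set[OF assms] assms(3)
    by (auto simp: total_dominating_set_def)
  show ?thesis
    unfolding total_dominating_set_def
  proof (intro conjI ballI subset_refl)
    fix x assume "x \<in> pverts (mycielski G)"
    then consider v where "v \<in> pverts G" "x = Orig v" | v where "v \<in> pverts G" "x = Copy v"
      | "x = Apex"
      by (auto simp: mycielski_def)
    then show "\<exists>u\<in>pverts (mycielski G). (x, u) \<in> parcs (mycielski G)"
    proof cases
      case 1
      with nbr obtain u where "u \<in> pverts G" "(v, u) \<in> parcs G" by blast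
      with 1 show ?thesis by (intro bexI[of _ "Orig u"]) (auto simp: mycielski_def)
    next
      case 2
      then show ?thesis by (intro bexI[of _ Apex]) (auto simp: mycielski_def)
    next
      case 3
      from ne obtain v where "v \<in> pverts G" by blast
      with 3 show ?thesis by (intro bexI[of _ "Copy v"]) (auto simp: mycielski_def)
    qed
  qed
qed

end

theory Submission
  imports Defs
begin

text \<open>
  Write \<open>n\<close> and \<open>m\<close> for the numbers of vertices and edges of \<open>G\<close>. The proof shows that passing to
  the Mycielski graph raises the total domination number by at most one and the annihilation
  number by at least one.

  For domination: if \<open>D\<close> is a total dominating set of \<open>G\<close> and \<open>x \<in> D\<close>, then \<open>D\<close> together with the
  copy of \<open>x\<close> is a total dominating set of the Mycielski graph. Indeed a vertex and its copy have
  the same neighbours in \<open>G\<close>, so \<open>D\<close> dominates both, and the copy of \<open>x\<close> dominates the apex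
  (\<open>total_dominating_set_mycielski\<close>).

  For annihilation: the Mycielski graph has \<open>3m + n\<close> edges, the copy of \<open>v\<close> has degree
  \<open>deg v + 1\<close>, and the apex has degree \<open>n\<close>. Let \<open>S\<close> consist of \<open>a(G)\<close> vertices of least degree, so
  that their degrees sum to at most \<open>m\<close>. The copies of \<open>S\<close> together with the apex are \<open>a(G) + 1\<close>
  vertices whose degrees sum to at most \<open>m + a(G) + n \<le> m + 2n\<close>. As no vertex is isolated,
  \<open>n \<le> 2m\<close>, so this sum is at most \<open>3m + n\<close>
  (\<open>annihilation_number_mycielski\<close>).
\<close>

section \<open>The annihilation number via vertex sets\<close>

text \<open>Removing the largest index from \<open>I\<close> leaves a set \<open>J\<close> with \<open>card J \<le> Max I\<close>, so that
  the last summand on the left is at most the one removed on the right.\<close>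

lemma sum_prefix_le_sum_nth:
  fixes ys :: "'b::{linorder, ordered_comm_monoid_add} list"
  assumes "sorted ys" "I \<subseteq> {..<length ys}"
  shows "(\<Sum>i<card I. ys ! i) \<le> (\<Sum>i\<in>I. ys ! i)"
  using assms(2)
proof (induction "card I" arbitrary: I)
  case 0
  then have "I = {}" by (metis card_0_eq finite_lessThan finite_subset)
  then show ?case by simp
next
  case (Suc k)
  have fin: "finite I" using Suc.prems finite_subset by blast
  have "I \<noteq> {}" using Suc.hyps(2) by auto
  define M where "M = Max I"
  have M: "M \<in> I" using fin \<open>I \<noteq> {}\<close> by (simp add: M_def)
  define J where "J = I - {M}"
  have kJ: "k = card J" using Suc.hyps(2) M fin by (simp add: J_def)
  have "J \<subseteq> {..<M}" using fin by (auto simp: J_def M_def intro: le_neq_trans)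
  then have "k \<le> M" unfolding kJ using card_mono[of "{..<M}" J] by simp
  then have last: "ys ! k \<le> ys ! M"
    using assms(1) M Suc.prems by (auto intro: sorted_nth_mono)
  have "(\<Sum>i<card I. ys ! i) = (\<Sum>i<card J. ys ! i) + ys ! k"
    using Suc.hyps(2) kJ by (metis sum.lessThan_Suc)
  also have "\<dots> \<le> (\<Sum>i\<in>J. ys ! i) + ys ! M"
    using Suc.hyps(1)[OF kJ] Suc.prems last by (intro add_mono) (auto simp: J_def)
  also have "\<dots> = (\<Sum>i\<in>I. ys ! i)"
    using fin M by (simp add: J_def sum.remove[of I M] add.commute)
  finally show ?case .
qed

lemma degree_sequence_enumeration:
  assumes "finite (pverts G)"
  obtains xs where "distinct xs" "set xs = pverts G"
    "degree_sequence G = map (out_degree (with_proj G)) xs"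
proof -
  let ?d = "out_degree (with_proj G)"
  obtain ys where ys: "set ys = pverts G" "distinct ys"
    using finite_distinct_list[OF assms] by blast
  define xs where "xs = sort_key ?d ys"
  have "mset xs = mset_set (pverts G)"
    using mset_set_set[OF ys(2)] ys(1) by (simp add: xs_def)
  then have "mset (degree_sequence G) = mset (map ?d xs)"
    by (simp add: degree_sequence_def)
  moreover have "sorted (degree_sequence G)" "sorted (map ?d xs)"
    by (simp_all add: degree_sequence_def xs_def)
  ultimately have "degree_sequence G = map ?d xs"
    by (metis properties_for_sort sorted_sort_id)
  with ys show thesis by (intro that[of xs]) (simp_all add: xs_def)
qed

text \<open>Together with \<open>annihilation_number_attained\<close>, this describes the annihilation number as the
  largest size of a vertex set whose degree sum is at most the number of edges, so that degree
  sequences need not be computed: among sets of a given size, the vertices that come first in the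
  degree sequence have the least degree sum.\<close>

lemma annihilation_number_ge:
  assumes "finite (pverts G)" "S \<subseteq> pverts G"
    and "(\<Sum>v\<in>S. out_degree (with_proj G) v) \<le> num_edges G"
  shows "card S \<le> annihilation_number G"
proof -
  let ?d = "out_degree (with_proj G)"
  obtain xs where xs: "distinct xs" "set xs = pverts G" "degree_sequence G = map ?d xs"
    using degree_sequence_enumeration[OF assms(1)] by blast
  define I where "I = {i. i < length xs \<and> xs ! i \<in> S}"
  have I: "I \<subseteq> {..<length (degree_sequence G)}" by (auto simp: I_def xs(3))
  have inj: "inj_on ((!) xs) I" using xs(1) by (auto simp: I_def inj_on_def nth_eq_iff_index_eq)
  have img: "(!) xs ` I = S"
  proof
    show "S \<subseteq> (!) xs ` I"
    proof
      fix v assume v: "v \<in> S"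
      then have "v \<in> set xs" using assms(2) xs(2) by blast
      then obtain i where "i < length xs" "xs ! i = v" by (auto simp: in_set_conv_nth)
      with v show "v \<in> (!) xs ` I" by (auto simp: I_def)
    qed
  qed (auto simp: I_def)
  have cardI: "card I = card S" using card_image[OF inj] img by simp
  have "(\<Sum>i<card S. degree_sequence G ! i) \<le> (\<Sum>i\<in>I. degree_sequence G ! i)"
    using sum_prefix_le_sum_nth[OF _ I] cardI by (simp add: degree_sequence_def)
  also have "\<dots> = (\<Sum>i\<in>I. ?d (xs ! i))"
    by (rule sum.cong) (auto simp: xs(3) I_def)
  also have "\<dots> = (\<Sum>v\<in>S. ?d v)"
    using sum.reindex[OF inj, of ?d] img by simp
  also have "\<dots> \<le> num_edges G" by fact
  finally show ?thesis
    unfolding annihilation_number_def using card_mono[OF assms(1,2)]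
    by (intro Max_ge) auto
qed

lemma annihilation_number_attained:
  assumes "finite (pverts G)"
  obtains S where "S \<subseteq> pverts G" "card S = annihilation_number G"
    "(\<Sum>v\<in>S. out_degree (with_proj G) v) \<le> num_edges G"
proof -
  let ?d = "out_degree (with_proj G)"
  let ?K = "{k. k \<le> card (pverts G) \<and> (\<Sum>i<k. degree_sequence G ! i) \<le> num_edges G}"
  define a where "a = annihilation_number G"
  obtain xs where xs: "distinct xs" "set xs = pverts G" "degree_sequence G = map ?d xs"
    using degree_sequence_enumeration[OF assms] by blast
  have "Max ?K \<in> ?K" by (rule Max_in) (auto intro: exI[of _ 0])
  then have "a \<in> ?K" by (simp only: a_def annihilation_number_def)
  then have a: "a \<le> length xs" "(\<Sum>i<a. degree_sequence G ! i) \<le> num_edges G"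
    using xs(1,2) distinct_card[of xs] by simp_all
  have "(\<Sum>v\<in>set (take a xs). ?d v) = sum_list (map ?d (take a xs))"
    using xs(1) by (simp add: sum_list_distinct_conv_sum_set)
  also have "\<dots> = (\<Sum>i<a. degree_sequence G ! i)"
    using a(1) by (simp add: sum_list_sum_nth xs(3) atLeast0LessThan)
  finally have "(\<Sum>v\<in>set (take a xs). ?d v) \<le> num_edges G"
    using a(2) by simp
  moreover have "card (set (take a xs)) = a"
    using xs(1) a(1) by (simp add: distinct_card)
  moreover have "set (take a xs) \<subseteq> pverts G" using xs(2) set_take_subset by metis
  ultimately show thesis using that a_def by blast
qed

section \<open>Counting edges and degrees in the Mycielski graph\<close>

lemma card_parcs_eq_num_edges:
  assumes "pair_graph G"
  shows "card (parcs G) = 2 * num_edges G"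
proof -
  interpret pair_graph G by fact
  let ?e = "\<lambda>a. {fst a, snd a}"
  have im: "?e ` parcs G = edges G" by (force simp: edges_def)
  have fib: "card {a \<in> parcs G. ?e a = e} = 2" if e: "e \<in> edges G" for e
  proof -
    obtain u v where uv: "e = {u, v}" "(u, v) \<in> parcs G" using e by (auto simp: edges_def)
    have "{a \<in> parcs G. ?e a = e} = {(u, v), (v, u)}"
      using uv arcs_symmetric by (auto simp: doubleton_eq_iff)
    moreover have "u \<noteq> v" using uv no_loops' by blast
    ultimately show ?thesis by simp
  qed
  have "card (parcs G) = (\<Sum>e\<in>?e ` parcs G. \<Sum>a\<in>{a \<in> parcs G. ?e a = e}. 1)"
    using sum.image_gen[of "parcs G" "\<lambda>_. 1::nat" ?e] by simp
  also have "\<dots> = 2 * num_edges G"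
    using fib by (simp add: im num_edges_def)
  finally show ?thesis .
qed

text \<open>Arcs are easier to count than edges: they split into five disjoint injective images,
  three of the arc set and two of the vertex set of \<open>G\<close>.\<close>

lemma num_edges_mycielski:
  assumes "pair_graph G"
  shows "num_edges (mycielski G) = 3 * num_edges G + card (pverts G)"
proof -
  interpret pair_graph G by fact
  let ?A = "parcs G" and ?V = "pverts G"
  let ?OO = "map_prod Orig Orig ` ?A" and ?CO = "map_prod Copy Orig ` ?A"
    and ?OC = "map_prod Orig Copy ` ?A"
    and ?WC = "(\<lambda>v. (Apex :: 'a mycielski_vertex, Copy v)) ` ?V"
    and ?CW = "(\<lambda>v. (Copy v, Apex :: 'a mycielski_vertex)) ` ?V"
  have parcs: "parcs (mycielski G) = ?OO \<union> (?CO \<union> (?OC \<union> (?WC \<union> ?CW)))"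
    by (force simp: mycielski_def)
  have fin: "finite ?A" "finite ?V" by auto
  have "card ?OO = card ?A" "card ?CO = card ?A" "card ?OC = card ?A"
    "card ?WC = card ?V" "card ?CW = card ?V"
    by (rule card_image; auto simp: inj_on_def)+
  moreover have "card (parcs (mycielski G))
      = card ?OO + (card ?CO + (card ?OC + (card ?WC + card ?CW)))"
    unfolding parcs
    by (subst card_Un_disjoint, (use fin in auto)[3])+ simp
  ultimately have "card (parcs (mycielski G)) = 3 * card ?A + 2 * card ?V" by simp
  then show ?thesis
    using card_parcs_eq_num_edges[OF assms]
      card_parcs_eq_num_edges[OF pair_graph_mycielski[OF assms]] by simp
qed

lemma out_degree_mycielski_Copy:
  assumes "pair_graph G" "v \<in> pverts G"
  shows "out_degree (with_proj (mycielski G)) (Copy v) = out_degree (with_proj G) v + 1"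
proof -
  interpret pair_graph G by fact
  let ?out = "{a \<in> parcs G. fst a = v}"
  have "{a \<in> parcs (mycielski G). fst a = Copy v}
      = insert (Copy v, Apex) (map_prod Copy Orig ` ?out)"
    using assms(2) by (force simp: mycielski_def)
  moreover have "card (map_prod Copy Orig ` ?out) = card ?out"
    by (rule card_image) (auto simp: inj_on_def)
  moreover have "finite ?out" by simp
  ultimately show ?thesis
    by (simp add: out_degree_def out_arcs_def card_insert_if image_iff)
qed

lemma out_degree_mycielski_Apex:
  "out_degree (with_proj (mycielski G)) Apex = card (pverts G)"
proof -
  have "{a \<in> parcs (mycielski G). fst a = Apex} = (\<lambda>v. (Apex, Copy v)) ` pverts G"
    by (auto simp: mycielski_def)
  then show ?thesis
    by (simp add: out_degree_def out_arcs_def card_image inj_on_def)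
qed

section \<open>Effect of the Mycielski construction on the two invariants\<close>

text \<open>Copies of an extremal set for \<open>G\<close> have degree sum at most \<open>m + n\<close>, which leaves room for
  the apex, of degree \<open>n\<close>, since \<open>n \<le> 2m\<close> in a graph without isolated vertices.\<close>

lemma annihilation_number_mycielski:
  assumes "pair_graph G" and "\<And>v. v \<in> pverts G \<Longrightarrow> \<exists>u. (v, u) \<in> parcs G"
  shows "annihilation_number G + 1 \<le> annihilation_number (mycielski G)"
proof -
  interpret pair_graph G by fact
  interpret M: pair_graph "mycielski G" using assms(1) by (rule pair_graph_mycielski)
  let ?d = "out_degree (with_proj G)" and ?d' = "out_degree (with_proj (mycielski G))"
  obtain S where S: "S \<subseteq> pverts G" "card S = annihilation_number G"
    "(\<Sum>v\<in>S. ?d v) \<le> num_edges G"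
    using annihilation_number_attained[of G] by auto
  have finS: "finite S" using S(1) pair_finite_verts by (rule finite_subset)
  define T where "T = insert Apex (Copy ` S)"
  \<comment> \<open>Every vertex is the tail of some arc, and there are \<open>2m\<close> arcs.\<close>
  have "pverts G \<subseteq> fst ` parcs G" using assms(2) by force
  then have "card (pverts G) \<le> card (parcs G)" by (intro surj_card_le) auto
  then have nm: "card (pverts G) \<le> 2 * num_edges G"
    using card_parcs_eq_num_edges[OF assms(1)] by simp
  have "(\<Sum>x\<in>T. ?d' x) = card (pverts G) + (\<Sum>x\<in>Copy ` S. ?d' x)"
    using finS by (subst T_def, subst sum.insert) (auto simp: out_degree_mycielski_Apex)
  also have "(\<Sum>x\<in>Copy ` S. ?d' x) = (\<Sum>v\<in>S. ?d' (Copy v))"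
    by (subst sum.reindex) (auto simp: inj_on_def)
  also have "\<dots> = (\<Sum>v\<in>S. ?d v + 1)"
    using S(1) by (intro sum.cong) (auto simp: out_degree_mycielski_Copy[OF assms(1)])
  also have "\<dots> = (\<Sum>v\<in>S. ?d v) + card S" by (simp only: sum.distrib card_eq_sum)
  finally have "(\<Sum>x\<in>T. ?d' x) \<le> num_edges (mycielski G)"
    using S(3) nm card_mono[OF _ S(1)] by (simp add: num_edges_mycielski[OF assms(1)])
  moreover have "T \<subseteq> pverts (mycielski G)" using S(1) by (auto simp: T_def mycielski_def)
  ultimately have "card T \<le> annihilation_number (mycielski G)"
    by (intro annihilation_number_ge) auto
  moreover have "card T = card S + 1"
    using finS by (simp add: T_def card_insert_if card_image inj_on_def image_iff)
  ultimately show ?thesis using S(2) by simp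
qed

text \<open>An original vertex and its copy are both adjacent to the original of any neighbour in \<open>D\<close>;
  the extra copy is there only for the apex, whose neighbours are exactly the copies.\<close>

lemma total_dominating_set_mycielski:
  assumes "total_dominating_set G D" "x \<in> D"
  shows "total_dominating_set (mycielski G) (insert (Copy x) (Orig ` D))"
  using assms unfolding total_dominating_set_def mycielski_def by auto

lemma finite_total_dominating_set_cards:
  assumes "finite (pverts G)"
  shows "finite {card D | D. total_dominating_set G D}"
proof (rule finite_subset)
  show "{card D | D. total_dominating_set G D} \<subseteq> card ` Pow (pverts G)"
    by (auto simp: total_dominating_set_def)
qed (use assms in simp)

lemma total_domination_number_le:
  assumes "finite (pverts G)" "total_dominating_set G D"
  shows "total_domination_number G \<le> card D"
  unfolding total_domination_number_def
  using finite_total_dominating_set_cards[OF assms(1)] assms(2) by (intro Min_le) auto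

lemma total_domination_number_attained:
  assumes "finite (pverts G)" "total_dominating_set G D\<^sub>0"
  obtains D where "total_dominating_set G D" "card D = total_domination_number G"
proof -
  have "total_domination_number G \<in> {card D | D. total_dominating_set G D}"
    unfolding total_domination_number_def
    using finite_total_dominating_set_cards[OF assms(1)] assms(2) by (intro Min_in) auto
  then show thesis using that by auto
qed

lemma total_domination_number_mycielski:
  assumes "pair_graph G" "pverts G \<noteq> {}" "total_dominating_set G D\<^sub>0"
  shows "total_domination_number (mycielski G) \<le> total_domination_number G + 1"
proof -
  interpret pair_graph G by fact
  interpret M: pair_graph "mycielski G" using assms(1) by (rule pair_graph_mycielski)
  obtain D where D: "total_dominating_set G D" "card D = total_domination_number G"
    using total_domination_number_attained[OF _ assms(3)] by auto
  then obtain x where x: "x \<in> D" using assms(2) by (auto simp: total_dominating_set_def)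
  have "D \<subseteq> pverts G" using D(1) by (simp add: total_dominating_set_def)
  then have "finite D" using pair_finite_verts by (rule finite_subset)
  have "total_domination_number (mycielski G) \<le> card (insert (Copy x) (Orig ` D))"
    using total_dominating_set_mycielski[OF D(1) x] by (intro total_domination_number_le) auto
  also have "\<dots> = card D + 1"
    using \<open>finite D\<close> by (simp add: card_insert_if card_image inj_on_def image_iff)
  finally show ?thesis using D(2) by simp
qed

theorem proposition3p4:
  fixes G :: "'a pair_pre_digraph"
  assumes "pair_graph G"
    and "connected (with_proj G)"
    and "card (pverts G) \<ge> 2"
    and "total_domination_number G \<le> annihilation_number G + 1"
  shows "total_domination_number (mycielski G) \<le> annihilation_number (mycielski G) + 1"
proof -
  have tds: "total_dominating_set G (pverts G)"
    using ex_total_dominating_set assms(1-3) by blast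
  have "total_domination_number (mycielski G) \<le> total_domination_number G + 1"
    using total_domination_number_mycielski[OF assms(1) _ tds] assms(3) by fastforce
  also have "\<dots> \<le> annihilation_number G + 1 + 1"
    using assms(4) by simp
  also have "\<dots> \<le> annihilation_number (mycielski G) + 1"
    using annihilation_number_mycielski[OF assms(1)] tds
    by (auto simp: total_dominating_set_def)
  finally show ?thesis .
qed

end
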